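(* Let $\mathcal P=(P,\leq,f_i:i\in I)$ be an isotone poset expansion, let $\phi(x_1,\ldots,x_n)$ and $\psi(x_1,\ldots,x_n)$ be terms in the language of $\mathcal P$, and let $\Gamma$ be a standard closure operator on the lattice of up-sets of $P$ ordered by inclusion. Let $\Gamma[\mathcal P]=(\Gamma[P^*],\supseteq,\gamma_i^+:i\in I)$ be the induced structure on $\Gamma$-closed up-sets. Suppose that for all $(C_1,\ldots,C_n)\in\Gamma[P^*]^n$ the value $\psi(C_1,\ldots,C_n)$ of $\psi$ in $\Gamma[\mathcal P]$ satisfies $$\psi(C_1,\ldots,C_n)=\Gamma\big(\psi[C_1\times\cdots\times C_n]^\uparrow\big).$$ Then $$\mathcal P\models\phi(x_1,\ldots,x_n)\leq\psi(x_1,\ldots,x_n)\ \Longrightarrow\ \Gamma[\mathcal P]\models\phi(x_1,\ldots,x_n)\leq\psi(x_1,\ldots,x_n),$$ where $\leq$ is interpreted in $\Gamma[\mathcal P]$ as $\supseteq$, and satisfaction of an inequality means satisfaction under all assignments of the variables.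
   Context: An isotone poset expansion $\mathcal P=(P,\leq,f_i:i\in I)$ is a poset $(P,\leq)$ with operations $f_i\colon P^{n_i}\to P$ ($n_i\in\mathbb N$, $n_i=0$ allowed, giving constants), each order preserving in the product order. Terms in the language of $\mathcal P$ are first-order terms built from variables and the function symbols $f_i$. For $S\subseteq P$, $S^\uparrow=\{p\in P:\exists s\in S,\ s\leq p\}$ and $p^\uparrow=\{p\}^\uparrow$. The up-sets of $P$ (including $\emptyset$) form $P^*$ when ordered by reverse inclusion, and the order dual $P^{*\delta}$ when ordered by inclusion. A standard closure operator is a map $\Gamma\colon P^{*\delta}\to P^{*\delta}$ with $S\subseteq\Gamma(S)$; $S\subseteq T\Rightarrow\Gamma(S)\subseteq\Gamma(T)$; $\Gamma(\Gamma(S))=\Gamma(S)$; and $\Gamma(p^\uparrow)=p^\uparrow$ for all $p\in P$. $\Gamma[P^*]$ is the set of $\Gamma$-closed up-sets (those $C$ with $\Gamma(C)=C$), ordered by reverse inclusion ($C\leq D\iff C\supseteq D$). For each $f_i$ of arity $m$, the lifted operation is $\gamma_i^+(C_1,\ldots,C_m)=\Gamma(f_i[C_1\times\cdots\times C_m]^\uparrow)$, where $f[C_1\times\cdots\times C_m]=\{f(c_1,\ldots,c_m):c_j\in C_j\}$ (empty if some $C_j$ is empty); for a constant $f$ the lift is $\{f\}^\uparrow$. The structure $\Gamma[\mathcal P]=(\Gamma[P^*],\supseteq,\gamma_i^+:i\in I)$ interprets each symbol $f_i$ as $\gamma_i^+$, and $\phi(C_1,\ldots,C_n)$ denotes the value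 of the term $\phi$ in $\Gamma[\mathcal P]$ under $x_j\mapsto C_j$. For a term $\phi(x_1,\ldots,x_n)$, $\phi[C_1\times\cdots\times C_n]=\{\phi(c_1,\ldots,c_n):c_j\in C_j \text{ for all } j\}\subseteq P$, where $\phi(c_1,\ldots,c_n)$ is evaluated in $\mathcal P$. *)

theory Defs
  imports Main
begin

text \<open>
  Carriers are explicit sets (the empty poset is allowed), and an \<open>n\<close>-tuple is a list of
  length \<open>n\<close>.  The value of an operation is meaningful only for symbols in \<open>symbols\<close>
  and for tuples over the carrier of the right length.
\<close>

record ('f, 'a) ordered_structure =
  carrier :: "'a set"
  leq :: "'a rel"
  symbols :: "'f set"
  arity :: "'f \<Rightarrow> nat"
  oper :: "'f \<Rightarrow> 'a list \<Rightarrow> 'a"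

definition tuples :: "'a set \<Rightarrow> nat \<Rightarrow> 'a list set" where
  "tuples A n = {xs. length xs = n \<and> set xs \<subseteq> A}"

definition isotone_poset_expansion :: "('f, 'a) ordered_structure \<Rightarrow> bool" where
  "isotone_poset_expansion P \<longleftrightarrow>
     partial_order_on (carrier P) (leq P) \<and>
     (\<forall>f\<in>symbols P.
        (\<forall>xs\<in>tuples (carrier P) (arity P f). oper P f xs \<in> carrier P) \<and>
        (\<forall>xs\<in>tuples (carrier P) (arity P f). \<forall>ys\<in>tuples (carrier P) (arity P f).
           list_all2 (\<lambda>x y. (x, y) \<in> leq P) xs ys \<longrightarrow>
           (oper P f xs, oper P f ys) \<in> leq P))"


subsection \<open>Terms\<close>

text \<open>\<open>Var j\<close> is the variable written \<open>x\<close> with index \<open>j + 1\<close> in the usual 1-based notation.\<close>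

datatype 'f trm = Var nat | App 'f "'f trm list"

inductive_set terms :: "('f, 'a) ordered_structure \<Rightarrow> nat \<Rightarrow> 'f trm set"
  for P :: "('f, 'a) ordered_structure" and n :: nat where
  Var: "j < n \<Longrightarrow> Var j \<in> terms P n"
| App: "f \<in> symbols P \<Longrightarrow> length ts = arity P f \<Longrightarrow> \<forall>t\<in>set ts. t \<in> terms P n \<Longrightarrow>
        App f ts \<in> terms P n"

fun term_value :: "('f, 'a) ordered_structure \<Rightarrow> 'f trm \<Rightarrow> 'a list \<Rightarrow> 'a" where
  "term_value P (Var j) xs = xs ! j"
| "term_value P (App f ts) xs = oper P f (map (\<lambda>t. term_value P t xs) ts)"

definition satisfies_le ::
  "('f, 'a) ordered_structure \<Rightarrow> nat \<Rightarrow> 'f trm \<Rightarrow> 'f trm \<Rightarrow> bool" where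
  "satisfies_le P n s t \<longleftrightarrow>
     (\<forall>xs\<in>tuples (carrier P) n. (term_value P s xs, term_value P t xs) \<in> leq P)"


subsection \<open>Up-sets and standard closure operators\<close>

definition up :: "('f, 'a) ordered_structure \<Rightarrow> 'a set \<Rightarrow> 'a set" where
  "up P S = {p \<in> carrier P. \<exists>s\<in>S. (s, p) \<in> leq P}"

definition upsets :: "('f, 'a) ordered_structure \<Rightarrow> 'a set set" where
  "upsets P = {S. S \<subseteq> carrier P \<and> (\<forall>s\<in>S. \<forall>p\<in>carrier P. (s, p) \<in> leq P \<longrightarrow> p \<in> S)}"

text \<open>Only the restriction of \<open>\<Gamma>\<close> to up-sets matters.\<close>

definition standard_closure_operator ::
  "('f, 'a) ordered_structure \<Rightarrow> ('a set \<Rightarrow> 'a set) \<Rightarrow> bool" where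
  "standard_closure_operator P \<Gamma> \<longleftrightarrow>
     (\<forall>S\<in>upsets P. \<Gamma> S \<in> upsets P) \<and>
     (\<forall>S\<in>upsets P. S \<subseteq> \<Gamma> S) \<and>
     (\<forall>S\<in>upsets P. \<forall>T\<in>upsets P. S \<subseteq> T \<longrightarrow> \<Gamma> S \<subseteq> \<Gamma> T) \<and>
     (\<forall>S\<in>upsets P. \<Gamma> (\<Gamma> S) = \<Gamma> S) \<and>
     (\<forall>p\<in>carrier P. \<Gamma> (up P {p}) = up P {p})"

definition closed_upsets ::
  "('f, 'a) ordered_structure \<Rightarrow> ('a set \<Rightarrow> 'a set) \<Rightarrow> 'a set set" where
  "closed_upsets P \<Gamma> = {C \<in> upsets P. \<Gamma> C = C}"


subsection \<open>The induced structure on closed up-sets\<close>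

text \<open>\<open>listset [C\<^sub>1, \<dots>, C\<^sub>m]\<close> is the product of the sets \<open>C\<^sub>j\<close>, as a set of lists of length \<open>m\<close>.\<close>

definition lifted_oper ::
  "('f, 'a) ordered_structure \<Rightarrow> ('a set \<Rightarrow> 'a set) \<Rightarrow> 'f \<Rightarrow> 'a set list \<Rightarrow> 'a set" where
  "lifted_oper P \<Gamma> f Cs =
     (if arity P f = 0 then up P {oper P f []}
      else \<Gamma> (up P (oper P f ` listset Cs)))"

definition induced_structure ::
  "('f, 'a) ordered_structure \<Rightarrow> ('a set \<Rightarrow> 'a set) \<Rightarrow> ('f, 'a set) ordered_structure" where
  "induced_structure P \<Gamma> =
     \<lparr>carrier = closed_upsets P \<Gamma>,
      leq = {(C, D). C \<in> closed_upsets P \<Gamma> \<and> D \<in> closed_upsets P \<Gamma> \<and> C \<supseteq> D},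
      symbols = symbols P,
      arity = arity P,
      oper = lifted_oper P \<Gamma>\<rparr>"

end

theory Submission
  imports Defs
begin

text \<open>
  Closing under \<open>\<Gamma>\<close> after each operation can only enlarge a set: the pointwise image
  \<open>t[C\<^sub>1 \<times> \<dots> \<times> C\<^sub>n]\<close> of a term is always contained in its value \<open>t(C\<^sub>1, \<dots>, C\<^sub>n)\<close> in the induced
  structure (\<open>term_value_mem_induced\<close>).  For \<open>\<psi>\<close> the hypothesis makes this
  containment as tight as possible, since \<open>\<psi>(C\<^sub>1, \<dots>, C\<^sub>n)\<close> is the \<^emph>\<open>least\<close> closed up-set
  containing the image of \<open>\<psi>\<close>.  It thus suffices that the image of \<open>\<psi>\<close> lies in the closed
  up-set \<open>\<phi>(C\<^sub>1, \<dots>, C\<^sub>n)\<close>.  This is so because each \<open>\<psi>(c)\<close> lies above \<open>\<phi>(c)\<close>, which belongs to that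
  up-set.

  If some \<open>C\<^sub>j\<close> is empty, both images are empty and the argument degenerates to \<open>\<Gamma>(\<emptyset>)\<close> being
  the least closed up-set.
\<close>

lemma mem_listset_iff: "xs \<in> listset Cs \<longleftrightarrow> list_all2 (\<in>) xs Cs"
proof (induction Cs arbitrary: xs)
  case (Cons C Cs)
  show ?case by (cases xs) (auto simp: set_Cons_def Cons.IH)
qed simp

lemma listset_subset_tuples:
  assumes "set Cs \<subseteq> Pow A"
  shows "listset Cs \<subseteq> tuples A (length Cs)"
  using assms
  by (fastforce simp: mem_listset_iff tuples_def list_all2_conv_all_nth in_set_conv_nth)

lemma closed_upset_subset_carrier: "C \<in> closed_upsets P \<Gamma> \<Longrightarrow> C \<subseteq> carrier P"
  by (auto simp: closed_upsets_def upsets_def)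

lemma up_in_upsets:
  assumes "isotone_poset_expansion P"
  shows "up P S \<in> upsets P"
proof -
  have "trans (leq P)"
    using assms by (simp add: isotone_poset_expansion_def partial_order_on_def preorder_on_def)
  then show ?thesis
    by (auto simp: up_def upsets_def dest: transD)
qed

lemma subset_up:
  assumes "isotone_poset_expansion P" and "S \<subseteq> carrier P"
  shows "S \<subseteq> up P S"
proof -
  have "refl_on (carrier P) (leq P)"
    using assms(1)
    by (simp add: isotone_poset_expansion_def partial_order_on_def preorder_on_def)
  then show ?thesis
    using assms(2) by (auto simp: up_def dest: refl_onD)
qed

lemma up_subset_upset:
  assumes "S \<subseteq> D" and "D \<in> upsets P"
  shows "up P S \<subseteq> D"
  using assms by (auto simp: up_def upsets_def)

lemma closure_up_closed:
  assumes "isotone_poset_expansion P" and "standard_closure_operator P \<Gamma>"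
  shows "\<Gamma> (up P S) \<in> closed_upsets P \<Gamma>"
  using up_in_upsets[OF assms(1)] assms(2)
  by (auto simp: closed_upsets_def standard_closure_operator_def)

lemma subset_closure_up:
  assumes "isotone_poset_expansion P" and "standard_closure_operator P \<Gamma>"
    and "S \<subseteq> carrier P"
  shows "S \<subseteq> \<Gamma> (up P S)"
proof -
  have "up P S \<subseteq> \<Gamma> (up P S)"
    using assms(2) up_in_upsets[OF assms(1)] by (simp add: standard_closure_operator_def)
  with subset_up[OF assms(1,3)] show ?thesis by (rule subset_trans)
qed

lemma closure_up_least:
  assumes "isotone_poset_expansion P" and "standard_closure_operator P \<Gamma>"
    and "D \<in> closed_upsets P \<Gamma>" and "S \<subseteq> D"
  shows "\<Gamma> (up P S) \<subseteq> D"
proof -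
  have D: "D \<in> upsets P" "\<Gamma> D = D"
    using assms(3) by (auto simp: closed_upsets_def)
  have "\<Gamma> (up P S) \<subseteq> \<Gamma> D"
    using assms(2) up_in_upsets[OF assms(1)] D(1) up_subset_upset[OF assms(4) D(1)]
    by (simp add: standard_closure_operator_def)
  with D(2) show ?thesis by simp
qed

text \<open>
  The separate clause for constants is only a simplification: the empty product has the empty
  tuple as its sole element, and \<open>\<Gamma>\<close> fixes principal up-sets.  Constants and proper operations
  can therefore be treated uniformly.
\<close>

lemma lifted_oper_eq:
  assumes "isotone_poset_expansion P" and "standard_closure_operator P \<Gamma>"
    and "f \<in> symbols P" and "length Cs = arity P f"
  shows "lifted_oper P \<Gamma> f Cs = \<Gamma> (up P (oper P f ` listset Cs))"
proof (cases "arity P f = 0")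
  case True
  then have "oper P f [] \<in> carrier P"
    using assms(1,3) by (auto simp: isotone_poset_expansion_def tuples_def)
  then have "\<Gamma> (up P {oper P f []}) = up P {oper P f []}"
    using assms(2) by (simp add: standard_closure_operator_def)
  with True assms(4) show ?thesis
    by (simp add: lifted_oper_def)
qed (simp add: lifted_oper_def)

lemma term_value_induced_closed:
  assumes "isotone_poset_expansion P" and "standard_closure_operator P \<Gamma>"
    and "t \<in> terms P n" and "Cs \<in> tuples (closed_upsets P \<Gamma>) n"
  shows "term_value (induced_structure P \<Gamma>) t Cs \<in> closed_upsets P \<Gamma>"
  using assms(3)
proof cases
  case (Var j)
  then show ?thesis
    using assms(4) by (auto simp: tuples_def)
next
  case (App f ts)
  then show ?thesis
    by (simp add: induced_structure_def lifted_oper_eq[OF assms(1,2)]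
        closure_up_closed[OF assms(1,2)])
qed

text \<open>
  By induction on the term: the values of the immediate subterms at \<open>xs\<close> form a point of the
  product of their values at \<open>Cs\<close>, so the operation maps them into the set that \<open>\<Gamma>\<close> then
  enlarges.
\<close>

lemma term_value_mem_induced:
  assumes "isotone_poset_expansion P" and "standard_closure_operator P \<Gamma>"
    and "t \<in> terms P n" and Cs: "Cs \<in> tuples (closed_upsets P \<Gamma>) n" and xs: "xs \<in> listset Cs"
  shows "term_value P t xs \<in> term_value (induced_structure P \<Gamma>) t Cs"
  using assms(3)
proof (induction t rule: terms.induct)
  case (Var j)
  then show ?case
    using Cs xs by (simp add: tuples_def mem_listset_iff list_all2_conv_all_nth)
next
  case (App f ts)
  let ?ys = "map (\<lambda>t. term_value P t xs) ts"
  let ?Ds = "map (\<lambda>t. term_value (induced_structure P \<Gamma>) t Cs) ts"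
  have ys: "?ys \<in> listset ?Ds"
    using App.IH by (auto simp: mem_listset_iff list_all2_conv_all_nth)
  have "set ?Ds \<subseteq> closed_upsets P \<Gamma>"
    using App.IH term_value_induced_closed[OF assms(1,2) _ Cs] by auto
  then have "listset ?Ds \<subseteq> tuples (carrier P) (arity P f)"
    using listset_subset_tuples[of ?Ds "carrier P"] closed_upset_subset_carrier App.hyps(2)
    by fastforce
  then have "oper P f ` listset ?Ds \<subseteq> carrier P"
    using assms(1) App.hyps(1) by (auto simp: isotone_poset_expansion_def)
  then have "oper P f ?ys \<in> \<Gamma> (up P (oper P f ` listset ?Ds))"
    using subset_closure_up[OF assms(1,2)] ys by blast
  also have "\<dots> = lifted_oper P \<Gamma> f ?Ds"
    using lifted_oper_eq[OF assms(1,2) App.hyps(1), of ?Ds] App.hyps(2) by simp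
  finally show ?case
    by (simp add: induced_structure_def)
qed

theorem corollary5p7:
  fixes P :: "('f, 'a) ordered_structure"
    and \<Gamma> :: "'a set \<Rightarrow> 'a set"
    and n :: nat
    and \<phi> \<psi> :: "'f trm"
  assumes "isotone_poset_expansion P"
    and "\<phi> \<in> terms P n"
    and "\<psi> \<in> terms P n"
    and "standard_closure_operator P \<Gamma>"
    and "\<forall>Cs\<in>tuples (closed_upsets P \<Gamma>) n.
           term_value (induced_structure P \<Gamma>) \<psi> Cs = \<Gamma> (up P (term_value P \<psi> ` listset Cs))"
    and "satisfies_le P n \<phi> \<psi>"
  shows "satisfies_le (induced_structure P \<Gamma>) n \<phi> \<psi>"
proof -
  let ?Q = "induced_structure P \<Gamma>"
  have "term_value ?Q \<psi> Cs \<subseteq> term_value ?Q \<phi> Cs"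
    if Cs: "Cs \<in> tuples (closed_upsets P \<Gamma>) n" for Cs
  proof -
    note closed = term_value_induced_closed[OF assms(1,4) _ Cs]
    note mem = term_value_mem_induced[OF assms(1,4) _ Cs]
    have "term_value P \<psi> xs \<in> term_value ?Q \<phi> Cs" if xs: "xs \<in> listset Cs" for xs
    proof -
      have "set Cs \<subseteq> Pow (carrier P)"
        using Cs closed_upset_subset_carrier by (fastforce simp: tuples_def)
      then have "xs \<in> tuples (carrier P) n"
        using listset_subset_tuples[of Cs "carrier P"] xs Cs by (auto simp: tuples_def)
      then have "(term_value P \<phi> xs, term_value P \<psi> xs) \<in> leq P"
        using assms(6) by (simp add: satisfies_le_def)
      moreover have "term_value P \<phi> xs \<in> term_value ?Q \<phi> Cs"
        using mem[OF assms(2) xs] .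
      moreover have "term_value P \<psi> xs \<in> carrier P"
        using mem[OF assms(3) xs] closed_upset_subset_carrier[OF closed[OF assms(3)]] by blast
      ultimately show ?thesis
        using closed[OF assms(2)] by (auto simp: closed_upsets_def upsets_def)
    qed
    then have "\<Gamma> (up P (term_value P \<psi> ` listset Cs)) \<subseteq> term_value ?Q \<phi> Cs"
      by (intro closure_up_least[OF assms(1,4) closed[OF assms(2)]]) auto
    with assms(5) Cs show ?thesis by simp
  qed
  then show ?thesis
    using term_value_induced_closed[OF assms(1,4)] assms(2,3)
    by (simp add: satisfies_le_def induced_structure_def)
qed

end
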